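(* Let $L$ be a field that is an algebraic extension of its prime field (e.g. a finite field or a number field). Then the third axiom in the definition of an $L$-quadratic form is superfluous: for all $L$-vector spaces $M,N$, every map $q\colon M\to N$ satisfying (1) $q(\lambda x)=\lambda^2 q(x)$ and (2) $q(x+y+z)+q(x)+q(y)+q(z)=q(x+y)+q(x+z)+q(y+z)$ for all $\lambda\in L$ and $x,y,z\in M$ also satisfies (3) $q(\lambda x+\mu y)+\lambda\mu(q(x)+q(y))=\lambda\mu\, q(x+y)+q(\lambda x)+q(\mu y)$ for all $\lambda,\mu\in L$ and $x,y\in M$.
   Context: For a commutative ring $S$ and $S$-modules $M,N$, an $S$-quadratic map $M\to N$ is a map satisfying axioms (1), (2), (3) with $L$ replaced by $S$. The prime field of $L$ is $\mathbb{Q}$ if $L$ has characteristic $0$ and $\mathbb{F}_p$ if $L$ has characteristic $p>0$. *)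

theory Defs
  imports Complex_Main "HOL-Computational_Algebra.Computational_Algebra" "HOL-Number_Theory.Cong"
begin

(* inverse 0 = 0, so closure under inverse need not exclude 0 *)
definition is_subfield :: "'a::field set \<Rightarrow> bool" where
  "is_subfield K \<longleftrightarrow>
     0 \<in> K \<and> 1 \<in> K \<and>
     (\<forall>a\<in>K. \<forall>b\<in>K. a - b \<in> K) \<and>
     (\<forall>a\<in>K. \<forall>b\<in>K. a * b \<in> K) \<and>
     (\<forall>a\<in>K. inverse a \<in> K)"

definition prime_field :: "'a::field set" where
  "prime_field = \<Inter> {K. is_subfield K}"

definition algebraic_over :: "'a::field set \<Rightarrow> 'a \<Rightarrow> bool" where
  "algebraic_over K x \<longleftrightarrow> (\<exists>p. p \<noteq> 0 \<and> (\<forall>i. coeff p i \<in> K) \<and> poly p x = 0)"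

definition algebraic_over_prime_field :: "'a::field itself \<Rightarrow> bool" where
  "algebraic_over_prime_field _ \<longleftrightarrow> (\<forall>x::'a. algebraic_over prime_field x)"

lemma is_subfield_of_int:
  assumes "is_subfield K"
  shows "(of_int n :: 'a::field) \<in> K"
proof -
  have diff: "a - b \<in> K" if "a \<in> K" "b \<in> K" for a b
    using assms that unfolding is_subfield_def by blast
  have zero: "0 \<in> K" and one: "1 \<in> K"
    using assms unfolding is_subfield_def by blast+
  have neg: "- a \<in> K" if "a \<in> K" for a
    using diff[OF zero that] by simp
  have nat: "of_nat m \<in> K" for m
  proof (induction m)
    case 0
    show ?case using zero by simp
  next
    case (Suc m)
    show ?case using diff[OF one neg[OF Suc]] by simp
  qed
  show ?thesis
    by (cases n rule: int_cases2) (use nat neg in auto)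
qed

lemma prime_field_eq_fractions:
  "(prime_field :: 'a::field set) = {of_int a / of_int b |a b. of_int b \<noteq> (0::'a)}"
  (is "_ = ?F")
proof
  have "is_subfield ?F"
    unfolding is_subfield_def
  proof (intro conjI ballI)
    have "(0::'a) = of_int 0 / of_int 1" "of_int 1 \<noteq> (0::'a)" by simp_all
    then show "0 \<in> ?F" by blast
    have "(1::'a) = of_int 1 / of_int 1" "of_int 1 \<noteq> (0::'a)" by simp_all
    then show "1 \<in> ?F" by blast
  next
    fix x y :: 'a assume "x \<in> ?F" "y \<in> ?F"
    then obtain a b c d where x: "x = of_int a / of_int b" "of_int b \<noteq> (0::'a)"
      and y: "y = of_int c / of_int d" "of_int d \<noteq> (0::'a)" by blast
    have "x - y = of_int (a * d - c * b) / of_int (b * d)" "of_int (b * d) \<noteq> (0::'a)"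
      using x y by (simp_all add: diff_frac_eq)
    then show "x - y \<in> ?F" by blast
    have "x * y = of_int (a * c) / of_int (b * d)" using x y by simp
    with \<open>of_int (b * d) \<noteq> (0::'a)\<close> show "x * y \<in> ?F" by blast
  next
    fix x :: 'a assume "x \<in> ?F"
    then obtain a b where x: "x = of_int a / of_int b" "of_int b \<noteq> (0::'a)" by blast
    show "inverse x \<in> ?F"
    proof (cases "of_int a = (0::'a)")
      case True
      then have "inverse x = of_int 0 / of_int 1" using x by simp
      then show ?thesis by (metis (mono_tags, lifting) mem_Collect_eq of_int_1 zero_neq_one)
    next
      case False
      moreover have "inverse x = of_int b / of_int a" using x by simp
      ultimately show ?thesis by blast
    qed
  qed
  then show "prime_field \<subseteq> ?F" unfolding prime_field_def by blast
next
  show "?F \<subseteq> prime_field"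
  proof
    fix x :: 'a assume "x \<in> ?F"
    then obtain a b where x: "x = of_int a * inverse (of_int b)"
      by (auto simp: divide_inverse)
    have "x \<in> K" if "is_subfield K" for K
      using that is_subfield_of_int[OF that] unfolding x is_subfield_def by blast
    then show "x \<in> prime_field" unfolding prime_field_def by blast
  qed
qed

lemma prime_field_CHAR_0:
  assumes "CHAR('a::field) = 0"
  shows "(prime_field :: 'a set) = {of_int a / of_int b |a b. b \<noteq> 0}"
  using assms by (simp add: prime_field_eq_fractions of_int_eq_0_iff_char_dvd)

lemma prime_field_CHAR_pos:
  assumes "CHAR('a::field) > 0"
  shows "(prime_field :: 'a set) = range of_int"
proof
  show "range of_int \<subseteq> (prime_field :: 'a set)"
    unfolding prime_field_def using is_subfield_of_int by blast
next
  show "(prime_field :: 'a set) \<subseteq> range of_int"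
  proof
    fix x :: 'a assume "x \<in> prime_field"
    then obtain a b where x: "x = of_int a / of_int b" and b: "of_int b \<noteq> (0::'a)"
      unfolding prime_field_eq_fractions by blast
    have "prime (int CHAR('a))"
      using prime_CHAR_semidom[OF assms] by simp
    moreover have "\<not> int CHAR('a) dvd b"
      using b by (simp add: of_int_eq_0_iff_char_dvd)
    ultimately have "coprime b (int CHAR('a))"
      using prime_imp_coprime coprime_commute by blast
    then obtain c where "[b * c = 1] (mod int CHAR('a))"
      using cong_solve_coprime_int by blast
    then have "of_int (b * c) = (of_int 1 :: 'a)"
      by (simp only: of_int_eq_iff_cong_CHAR)
    then have "of_int b * of_int c = (1::'a)" by simp
    then have "x = of_int (a * c)"
      using b unfolding x by (simp add: field_simps)
    then show "x \<in> range of_int" by blast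
  qed
qed

end

(*
  The polar form B x y = q (x + y) - q x - q y is biadditive with B (a x) (a y) = a^2 B x y.
  Linearising the latter in a gives B (a x) (c y) + B (c x) (a y) = 2 a c B x y, hence
  B (a^2 x) y = 2 a B (a x) y - a^2 B x y.  Thus a |-> B (a x) y - a B x y behaves like a
  derivation: for a polynomial p over the prime field,
    B (p(a) x) y = p(a) B x y + p'(a) (B (a x) y - a B x y).
  Since the prime field is perfect, a is a root of such a p with p'(a) \<noteq> 0, so
  B (a x) y = a B x y.
*)
theory Submission
  imports Defs
begin

section \<open>Separable annihilators over the prime field\<close>

lemma prime_field_subset: "is_subfield K \<Longrightarrow> prime_field \<subseteq> K"
  unfolding prime_field_def by blast

lemma is_subfield_prime_field: "is_subfield (prime_field :: 'a::field set)"
  unfolding prime_field_def is_subfield_def by blast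

text \<open>Frobenius is a ring endomorphism. By minimality the prime field lies among its fixed
  points, which supplies the hypothesis \<open>frob\<close> below.\<close>

lemma is_subfield_frobenius_fixed:
  assumes "prime CHAR('a::field)"
  shows "is_subfield {x::'a. x ^ CHAR('a) = x}"
proof -
  have "(a - b) ^ CHAR('a) = a - b" if "a ^ CHAR('a) = a" "b ^ CHAR('a) = b" for a b :: 'a
    using freshmans_dream[OF assms refl, of "a - b" b] that by (simp add: eq_diff_eq)
  moreover have "CHAR('a) > 0"
    using assms prime_gt_0_nat by blast
  ultimately show ?thesis
    by (simp add: is_subfield_def power_mult_distrib power_inverse)
qed

text \<open>If p' = 0, only exponents divisible by P = \<open>CHAR('a)\<close> occur, so p = r(X^P);
  since Frobenius fixes the coefficients, r(x^P) = r(x)^P.\<close>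

lemma poly_eq_power_CHAR_if_pderiv_eq_0:
  fixes p :: "'a::field poly"
  assumes char: "prime CHAR('a)"
    and frob: "\<And>i. coeff p i ^ CHAR('a) = coeff p i"
    and "pderiv p = 0" and "degree p > 0"
  obtains r where "degree r < degree p" "\<And>i. coeff r i = coeff p (i * CHAR('a))"
    "r \<noteq> 0" "poly p x = poly r x ^ CHAR('a)"
proof -
  let ?P = "CHAR('a)" and ?d = "degree p"
  have P: "?P > 1"
    using char prime_gt_1_nat by blast
  define r where "r = (\<Sum>k\<le>?d. monom (coeff p (k * ?P)) k)"
  have coeff_r: "coeff r i = coeff p (i * ?P)" for i
  proof (cases "i \<le> ?d")
    case False
    moreover have "i \<le> i * ?P"
      using P by simp
    ultimately have "coeff p (i * ?P) = 0"
      by (intro coeff_eq_0) linarith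
    with False show ?thesis
      by (simp add: r_def coeff_sum)
  qed (simp add: r_def coeff_sum)
  have dvd: "?P dvd i" if "coeff p i \<noteq> 0" for i
  proof (cases i)
    case (Suc n)
    have "of_nat i * coeff p i = 0"
      using coeff_pderiv[of p n] \<open>pderiv p = 0\<close> Suc by simp
    with that show ?thesis
      by (simp only: mult_eq_0_iff of_nat_eq_0_iff_char_dvd) simp
  qed simp
  \<comment> \<open>The degree of \<open>p\<close> is a multiple of P, so the leading coefficient of
    \<open>p\<close> survives in \<open>r\<close>.\<close>
  have "coeff p ?d \<noteq> 0"
    using \<open>degree p > 0\<close> by auto
  with dvd obtain m where "?d = ?P * m"
    by (meson dvdE)
  then have "coeff r m \<noteq> 0"
    using \<open>coeff p ?d \<noteq> 0\<close> by (simp add: coeff_r mult.commute)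
  then have "r \<noteq> 0"
    by auto
  moreover have "degree r < ?d"
  proof -
    have "coeff r i = 0" if "i > ?d - 1" for i
    proof -
      have "i * 1 < i * ?P"
        using P that by (intro mult_strict_left_mono) auto
      then have "?d < i * ?P"
        using that by linarith
      then show ?thesis
        by (simp add: coeff_r coeff_eq_0)
    qed
    then have "degree r \<le> ?d - 1"
      by (intro degree_le) auto
    then show ?thesis
      using \<open>degree p > 0\<close> by linarith
  qed
  moreover have "poly p x = poly r x ^ ?P"
  proof -
    have "poly r x ^ ?P = (\<Sum>k\<le>?d. coeff p (k * ?P) * x ^ (k * ?P))"
      by (simp add: r_def poly_sum poly_monom freshmans_dream_sum[OF char refl]
          power_mult_distrib frob flip: power_mult)
    also have "\<dots> = (\<Sum>j\<in>(\<lambda>k. k * ?P) ` {..?d}. coeff p j * x ^ j)"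
      using P by (subst sum.reindex) (auto simp: inj_on_def)
    also have "\<dots> = (\<Sum>j\<le>?d. coeff p j * x ^ j)"
    \<comment> \<open>The index sets differ both ways: multiples of P above \<open>?d\<close> have
      zero coefficients, and so do the non-multiples of P up to \<open>?d\<close>.\<close>
    proof (rule sum.mono_neutral_cong)
      fix j assume j: "j \<in> {..?d} - (\<lambda>k. k * ?P) ` {..?d}"
      have "coeff p j = 0"
      proof (rule ccontr)
        assume "coeff p j \<noteq> 0"
        with dvd obtain k where k: "j = k * ?P"
          by (metis dvdE mult.commute)
        then have "k \<le> j"
          using P by simp
        moreover have "j \<le> ?d"
          using j by simp
        ultimately have "k \<le> ?d"
          by linarith
        with k j show False
          by blast
      qed
      then show "coeff p j * x ^ j = 0"
        by simp
    qed (use not_le in \<open>auto simp: coeff_eq_0\<close>)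
    finally show ?thesis
      by (simp add: poly_altdef)
  qed
  ultimately show ?thesis
    using that coeff_r by blast
qed

text \<open>An annihilator \<open>p\<close> of least degree works: p' = 0 would make
  \<open>p\<close> a P-th power at \<open>x\<close>, giving a smaller annihilator, and a nonzero p'
  vanishing at \<open>x\<close> would itself be one.\<close>

lemma algebraic_over_prime_field_separable:
  fixes x :: "'a::field"
  assumes "algebraic_over prime_field x"
  obtains p where "\<And>i. coeff p i \<in> prime_field" "poly p x = 0" "poly (pderiv p) x \<noteq> 0"
proof -
  define A where "A p \<longleftrightarrow> p \<noteq> 0 \<and> (\<forall>i. coeff p i \<in> prime_field) \<and> poly p x = 0" for p
  obtain p where p: "A p" and minimal: "\<And>r. A r \<Longrightarrow> degree p \<le> degree r"
    using assms ex_has_least_nat[of A _ degree]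
    unfolding algebraic_over_def A_def[symmetric] by blast
  have deg: "degree p > 0"
  proof (rule ccontr)
    assume "\<not> degree p > 0"
    then obtain c where "p = [:c:]"
      by (meson degree_eq_zeroE not_gr0)
    with p show False
      by (auto simp: A_def)
  qed
  have "pderiv p \<noteq> 0"
  proof
    assume pderiv: "pderiv p = 0"
    \<comment> \<open>This coefficient of p' forces the positive integer \<open>degree p\<close> to
      be 0 in the field, hence positive characteristic.\<close>
    have "of_nat (degree p) * lead_coeff p = (0::'a)"
      using coeff_pderiv[of p "degree p - 1"] deg pderiv by simp
    then have "of_nat (degree p) = (0::'a)"
      using p by (simp add: A_def)
    then have "CHAR('a) > 0"
      using deg CHAR_pos_iff by blast
    then have char: "prime CHAR('a)"
      by (rule prime_CHAR_semidom)
    have "coeff p i ^ CHAR('a) = coeff p i" for i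
      using prime_field_subset[OF is_subfield_frobenius_fixed[OF char]] p
      by (auto simp: A_def)
    then obtain r where r: "degree r < degree p" "\<And>i. coeff r i = coeff p (i * CHAR('a))"
        "r \<noteq> 0" "poly p x = poly r x ^ CHAR('a)"
      using poly_eq_power_CHAR_if_pderiv_eq_0[OF char _ pderiv deg] by metis
    then have "A r"
      using p by (simp add: A_def)
    with minimal r(1) show False
      by (meson not_le)
  qed
  have "of_int n \<in> (prime_field :: 'a set)" for n
    using is_subfield_of_int is_subfield_prime_field by blast
  then have "of_nat n * c \<in> prime_field" if "c \<in> prime_field" for n and c :: 'a
    using is_subfield_prime_field that unfolding is_subfield_def
    by (metis of_int_of_nat_eq)
  then have "coeff (pderiv p) i \<in> prime_field" for i
    using p by (simp add: coeff_pderiv A_def del: of_nat_Suc)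
  moreover have "degree (pderiv p) < degree p"
  proof -
    have "degree (pderiv p) \<le> degree p - 1"
      by (rule degree_le) (simp add: coeff_pderiv coeff_eq_0)
    then show ?thesis
      using deg by linarith
  qed
  ultimately have "poly (pderiv p) x \<noteq> 0"
    using minimal[of "pderiv p"] \<open>pderiv p \<noteq> 0\<close> by (auto simp: A_def)
  with p show ?thesis
    using that by (auto simp: A_def)
qed

section \<open>Biadditive maps that are homogeneous under simultaneous scaling\<close>

locale diagonally_homogeneous_biadditive =
  M: vector_space scaleM + N: vector_space scaleN
  for scaleM :: "'l::field \<Rightarrow> 'm::ab_group_add \<Rightarrow> 'm" (infixr \<open>*m\<close> 75)
    and scaleN :: "'l \<Rightarrow> 'n::ab_group_add \<Rightarrow> 'n" (infixr \<open>*n\<close> 75) +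
  fixes B :: "'m \<Rightarrow> 'm \<Rightarrow> 'n"
  assumes add_left: "B (x + y) z = B x z + B y z"
    and add_right: "B x (y + z) = B x y + B x z"
    and diag: "B (a *m x) (a *m y) = a\<^sup>2 *n B x y"
begin

lemma zero_left: "B 0 y = 0"
  using add_left[of 0 0 y] by simp

lemma diff_left: "B (x - y) z = B x z - B y z"
  using add_left[of "x - y" y z] by (simp add: eq_diff_eq)

lemma diag_linearised:
  "B (a *m x) (c *m y) + B (c *m x) (a *m y) = (2 * a * c) *n B x y"
proof -
  have "(a + c)\<^sup>2 *n B x y = B ((a + c) *m x) ((a + c) *m y)"
    by (simp add: diag)
  also have "\<dots> = a\<^sup>2 *n B x y + (B (a *m x) (c *m y) + B (c *m x) (a *m y)) + c\<^sup>2 *n B x y"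
    by (simp add: M.scale_left_distrib add_left add_right diag algebra_simps)
  finally have "B (a *m x) (c *m y) + B (c *m x) (a *m y)
      = (a + c)\<^sup>2 *n B x y - a\<^sup>2 *n B x y - c\<^sup>2 *n B x y"
    by (simp add: algebra_simps)
  also have "\<dots> = ((a + c)\<^sup>2 - a\<^sup>2 - c\<^sup>2) *n B x y"
    by (simp only: N.scale_left_diff_distrib)
  also have "(a + c)\<^sup>2 - a\<^sup>2 - c\<^sup>2 = 2 * a * c"
    by (simp add: power2_sum)
  finally show ?thesis .
qed

text \<open>Linearise at \<open>a *m x\<close> with second scalar 1; the mixed term
  \<open>B (a *m x) (a *m y)\<close> is then evaluated by \<open>diag\<close>.\<close>

lemma scale_square_left: "B ((a * a) *m x) y = (2 * a) *n B (a *m x) y - (a * a) *n B x y"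
  using diag_linearised[of a "a *m x" 1 y] diag[of a x y]
  by (simp add: power2_eq_square eq_diff_eq)

text \<open>Being a subfield, this set contains the prime field, so \<open>B\<close> is linear on
  the left over the prime field.\<close>

lemma is_subfield_linear_scalars:
  "is_subfield {a. \<forall>x y. B (a *m x) y = a *n B x y}" (is "is_subfield ?S")
  unfolding is_subfield_def
proof (intro conjI ballI)
  fix a assume a: "a \<in> ?S"
  show "inverse a \<in> ?S"
  proof (cases "a = 0")
    case False
    \<comment> \<open>Linearity in \<open>a\<close> is applied at \<open>inverse a *m x\<close>,
      then \<open>a\<close> is cancelled.\<close>
    have "a *n B (inverse a *m x) y = B (a *m inverse a *m x) y" for x y
      using a by (simp del: M.scale_scale)
    then have "a *n B (inverse a *m x) y = B x y" for x y
      using False by simp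
    then have "inverse a *n B x y = inverse a *n a *n B (inverse a *m x) y" for x y
      by (simp del: N.scale_scale)
    then show ?thesis
      using False by simp
  qed (use a in simp)
qed (auto simp: zero_left M.scale_left_diff_distrib N.scale_left_diff_distrib diff_left
    simp flip: M.scale_scale)

lemma poly_scale_left:
  assumes "\<And>i. coeff p i \<in> prime_field"
  shows "B (poly p a *m x) y = poly p a *n B x y + poly (pderiv p) a *n (B (a *m x) y - a *n B x y)"
  using assms
proof (induction p arbitrary: x)
  case 0
  then show ?case
    by (simp add: zero_left)
next
  case (pCons c p)
  let ?D = "B (a *m x) y - a *n B x y"
  have c: "c \<in> prime_field" and p: "coeff p i \<in> prime_field" for i
    using pCons.prems[of 0] pCons.prems[of "Suc i"] by simp_all
  have "B (c *m x) y = c *n B x y"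
    using prime_field_subset[OF is_subfield_linear_scalars] c by blast
  \<comment> \<open>The defect at \<open>a *m x\<close> is \<open>a\<close> times the defect at
    \<open>x\<close>; this is why the induction keeps \<open>x\<close> arbitrary.\<close>
  moreover have D: "B (a *m a *m x) y - a *n B (a *m x) y = a *n ?D"
    using scale_square_left[of a x y, unfolded mult_2 N.scale_left_distrib]
    by (simp add: algebra_simps)
  moreover have "B (poly p a *m a *m x) y = poly p a *n B (a *m x) y + poly (pderiv p) a *n a *n ?D"
    using pCons.IH[OF p, of "a *m x"] unfolding D .
  \<comment> \<open>Substituting B (a x) y = a B x y + \<open>?D\<close> produces the factor p(a) +
    a p'(a), the derivative of c + X p at \<open>a\<close>.\<close>
  ultimately show ?case
    by (simp add: pderiv_pCons M.scale_left_distrib add_left algebra_simps)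
qed

lemma scale_left:
  assumes "algebraic_over prime_field a"
  shows "B (a *m x) y = a *n B x y"
proof -
  obtain p where p: "\<And>i. coeff p i \<in> prime_field" "poly p a = 0" "poly (pderiv p) a \<noteq> 0"
    using algebraic_over_prime_field_separable[OF assms] by blast
  have "poly (pderiv p) a *n (B (a *m x) y - a *n B x y) = 0"
    using poly_scale_left[OF p(1), of a x y] p(2) by (simp add: zero_left)
  with p(3) show ?thesis
    by simp
qed

text \<open>The two one-sided scalings add up to 2 a B x y, so left linearity forces right
  linearity, also in characteristic 2.\<close>

lemma scale_right:
  assumes "algebraic_over prime_field a"
  shows "B x (a *m y) = a *n B x y"
proof -
  have "B x (a *m y) + a *n B x y = a *n B x y + a *n B x y"
    using diag_linearised[of 1 x a y] scale_left[OF assms, of x y]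
    by (simp flip: N.scale_left_distrib)
  then show ?thesis
    by simp
qed

end

section \<open>Polar forms of quadratic maps\<close>

theorem mainTheorem2:
  fixes scaleM :: "'l::field \<Rightarrow> 'm::ab_group_add \<Rightarrow> 'm"
    and scaleN :: "'l \<Rightarrow> 'n::ab_group_add \<Rightarrow> 'n"
    and q :: "'m \<Rightarrow> 'n"
  assumes "algebraic_over_prime_field TYPE('l)"
    and "vector_space scaleM"
    and "vector_space scaleN"
    and "\<forall>a x. q (scaleM a x) = scaleN (a\<^sup>2) (q x)"
    and "\<forall>x y z. q (x + y + z) + q x + q y + q z = q (x + y) + q (x + z) + q (y + z)"
  shows "\<forall>a b x y. q (scaleM a x + scaleM b y) + scaleN (a * b) (q x + q y)
           = scaleN (a * b) (q (x + y)) + q (scaleM a x) + q (scaleM b y)"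
proof (intro allI)
  fix a b x y
  define B where "B x y = q (x + y) - q x - q y" for x y
  interpret M: vector_space scaleM by fact
  interpret N: vector_space scaleN by fact
  \<comment> \<open>For the polar form, left additivity is axiom (2) rearranged; symmetry of
    \<open>B\<close> then gives right additivity, and axiom (1) gives \<open>diag\<close>.\<close>
  have add_left: "B (x + y) z = B x z + B y z" for x y z
    using assms(5)[rule_format, of x y z] by (simp add: B_def algebra_simps)
  interpret diagonally_homogeneous_biadditive scaleM scaleN B
  proof
    show "B (x + y) z = B x z + B y z" for x y z
      by (rule add_left)
    show "B x (y + z) = B x y + B x z" for x y z
      using add_left[of y z x] by (simp add: B_def add.commute diff_diff_add)
    show "B (scaleM a x) (scaleM a y) = scaleN (a\<^sup>2) (B x y)" for a x y
      using assms(4) by (simp add: B_def N.scale_right_diff_distrib flip: M.scale_right_distrib)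
  qed
  have "algebraic_over prime_field c" for c :: 'l
    using assms(1) unfolding algebraic_over_prime_field_def by blast
  then have "B (scaleM a x) (scaleM b y) = scaleN (a * b) (B x y)"
    by (simp add: scale_left scale_right)
  \<comment> \<open>Axiom (3) is bilinearity of \<open>B\<close> with \<open>B\<close>
    unfolded.\<close>
  then show "q (scaleM a x + scaleM b y) + scaleN (a * b) (q x + q y)
      = scaleN (a * b) (q (x + y)) + q (scaleM a x) + q (scaleM b y)"
    by (simp add: B_def algebra_simps)
qed

end
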